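(* Given a reference triangle $\triangle ABC$ with circumcenter $X_3$, let $\triangle A'B'C'$ be the $X_3$-anticevian triangle of $\triangle ABC$. Then $X_3$ (of $\triangle ABC$) is the point $P^*$ of $\triangle A'B'C'$, i.e. the unique point such that the conic $\mathcal{Y}^*$ through the six vertices of the three ellipses with foci $(B',C')$, $(C',A')$, $(A',B')$ passing through that point is a circle. Furthermore, (i) this circle $\mathcal{Y}^*$ of $\triangle A'B'C'$ is concentric with the circumcircle of $\triangle A'B'C'$, and (ii) its center lies on the line $X_4X_6$ of $\triangle ABC$.
   Context: The vertices of an ellipse are its two intersections with its focal axis (the line through the foci). For a triangle and a point $P$, the six vertices of the three P-ellipses (the ellipses with foci at the pairs of vertices of the triangle and passing through $P$) lie on a conic, denoted $\mathcal{Y}^*$. For a given triangle, $P^*$ denotes the unique point $P$ for which $\mathcal{Y}^*$ is a circle. Given $\triangle ABC$ and a point $Q$, the $Q$-anticevian triangle $\triangle A'B'C'$ is the triangle for which $\triangle ABC$ is the cevian triangle of $Q$, i.e. $A=A'Q\cap B'C'$, $B=B'Q\cap C'A'$, $C=C'Q\cap A'B'$. $X_4$ is the orthocenter and $X_6$ the symmedian point (barycentrics $[a^2:b^2:c^2]$, where $a,b,c$ are the sidelengths) of $\triangle ABC$.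
   Formalization: Uniqueness of the point is claimed only for acute ABC and only among points inside A'B'C', since over the whole plane a second point can make Y* a circle; the circle and parts (i), (ii) are proved for every ABC whose anticevian triangle exists. *)

theory Defs
  imports "HOL-Analysis.Analysis"
begin

type_synonym point = "real ^ 2"

text \<open>Triangle centers. The two definite descriptions are meaningful for non-collinear vertices.\<close>

definition circumcenter :: "point \<Rightarrow> point \<Rightarrow> point \<Rightarrow> point" where
  "circumcenter A B C = (THE X. dist X A = dist X B \<and> dist X B = dist X C)"

definition orthocenter :: "point \<Rightarrow> point \<Rightarrow> point \<Rightarrow> point" where
  "orthocenter A B C =
     (THE H. (H - A) \<bullet> (B - C) = 0 \<and> (H - B) \<bullet> (C - A) = 0 \<and> (H - C) \<bullet> (A - B) = 0)"

definition symmedian_point :: "point \<Rightarrow> point \<Rightarrow> point \<Rightarrow> point" where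
  "symmedian_point A B C =
     (1 / ((dist B C)\<^sup>2 + (dist C A)\<^sup>2 + (dist A B)\<^sup>2)) *\<^sub>R
       ((dist B C)\<^sup>2 *\<^sub>R A + (dist C A)\<^sup>2 *\<^sub>R B + (dist A B)\<^sup>2 *\<^sub>R C)"

definition acute_triangle :: "point \<Rightarrow> point \<Rightarrow> point \<Rightarrow> bool" where
  "acute_triangle A B C \<longleftrightarrow> \<not> collinear {A, B, C} \<and>
     (B - A) \<bullet> (C - A) > 0 \<and> (C - B) \<bullet> (A - B) > 0 \<and> (A - C) \<bullet> (B - C) > 0"

text \<open>For distinct points, \<open>affine hull {X, Y}\<close> is the line through \<open>X\<close> and \<open>Y\<close>.\<close>

definition is_anticevian_triangle ::
  "point \<Rightarrow> point \<Rightarrow> point \<Rightarrow> point \<Rightarrow> point \<Rightarrow> point \<Rightarrow> point \<Rightarrow> bool" where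
  "is_anticevian_triangle Q A B C A' B' C' \<longleftrightarrow> \<not> collinear {A', B', C'} \<and>
     affine hull {A', Q} \<inter> affine hull {B', C'} = {A} \<and>
     affine hull {B', Q} \<inter> affine hull {C', A'} = {B} \<and>
     affine hull {C', Q} \<inter> affine hull {A', B'} = {C}"

definition ellipse_through :: "point \<Rightarrow> point \<Rightarrow> point \<Rightarrow> point set" where
  "ellipse_through F G P = {X. dist X F + dist X G = dist P F + dist P G}"

text \<open>If \<open>P\<close> lies on the segment \<open>FG\<close>, the ellipse degenerates to that segment and
  \<open>ellipse_vertices F G P\<close> is the whole segment; such a \<open>P\<close> on a side of a triangle
  never satisfies \<open>Y_is_circle\<close> below.\<close>

definition ellipse_vertices :: "point \<Rightarrow> point \<Rightarrow> point \<Rightarrow> point set" where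
  "ellipse_vertices F G P = ellipse_through F G P \<inter> affine hull {F, G}"

definition six_vertices :: "point \<Rightarrow> point \<Rightarrow> point \<Rightarrow> point \<Rightarrow> point set" where
  "six_vertices A B C P = ellipse_vertices B C P \<union> ellipse_vertices C A P \<union> ellipse_vertices A B P"

definition conic :: "point set \<Rightarrow> bool" where
  "conic S \<longleftrightarrow> (\<exists>a b c d e f :: real. (a, b, c) \<noteq> (0, 0, 0) \<and>
     S = {X. a * (X $ 1)\<^sup>2 + b * (X $ 1) * (X $ 2) + c * (X $ 2)\<^sup>2
             + d * (X $ 1) + e * (X $ 2) + f = 0})"

text \<open>\<open>Y\<close> is the one and only conic through the vertices of the three \<open>P\<close>-ellipses.\<close>

definition is_Y_conic :: "point \<Rightarrow> point \<Rightarrow> point \<Rightarrow> point \<Rightarrow> point set \<Rightarrow> bool" where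
  "is_Y_conic A B C P Y \<longleftrightarrow> conic Y \<and> six_vertices A B C P \<subseteq> Y \<and>
     (\<forall>Z. conic Z \<and> six_vertices A B C P \<subseteq> Z \<longrightarrow> Z = Y)"

definition Y_is_circle :: "point \<Rightarrow> point \<Rightarrow> point \<Rightarrow> point \<Rightarrow> bool" where
  "Y_is_circle A B C P \<longleftrightarrow> (\<exists>Z r. r > 0 \<and> is_Y_conic A B C P (sphere Z r))"

text \<open>Uniqueness is among the points inside the triangle. Without this restriction no such point
  need exist: for the triangle with vertices \<open>(0, 2/3)\<close>, \<open>(sqrt 3, 1)\<close>, \<open>(- sqrt 3, 1)\<close>, the
  predicate \<open>Y_is_circle\<close> holds at the exterior point \<open>(0, 0)\<close> and at a point \<open>(0, y)\<close> with
  \<open>2/3 < y < 1\<close>.\<close>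

definition is_P_star :: "point \<Rightarrow> point \<Rightarrow> point \<Rightarrow> point \<Rightarrow> bool" where
  "is_P_star A B C P \<longleftrightarrow>
     P \<in> interior (convex hull {A, B, C}) \<and> Y_is_circle A B C P \<and>
     (\<forall>P' \<in> interior (convex hull {A, B, C}). Y_is_circle A B C P' \<longrightarrow> P' = P)"

end

theory Submission
  imports Defs
begin

text \<open>A circle carries the two vertices of the \<open>P\<close>-ellipse with foci \<open>F\<close>, \<open>G\<close> iff its center \<open>Z\<close> is
  equidistant from \<open>F\<close> and \<open>G\<close> and \<open>(PF + PG)\<^sup>2 - FG\<^sup>2 = 4 (r\<^sup>2 - ZF\<^sup>2)\<close>. So the six vertices of a triangle
  are concyclic iff the excess \<open>(PF + PG)\<^sup>2 - FG\<^sup>2\<close> is the same for its three sides, and the center is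
  then the circumcenter. For the anticevian triangle of the circumcenter of \<open>ABC\<close>, all three
  excesses are \<open>4 \<rho>\<close>, where \<open>\<rho>\<close> is the squared circumradius of \<open>ABC\<close>.

  The conic through the six vertices is unique because they are symmetric about the midpoints of
  the sides: a quadratic function that vanishes at them takes the same value at the three triangle
  vertices and is determined by this value.

  For the uniqueness of \<open>P\<close>, take two interior points of which \<open>Q\<close> has the larger excess. All three
  sums of distances are then larger for \<open>Q\<close> than for \<open>P\<close>. But \<open>Q\<close> lies in one of the triangles
  \<open>PBC\<close>, \<open>PCA\<close>, \<open>PAB\<close>, say \<open>PBC\<close>, so \<open>QB + QC \<le> PB + PC\<close>. Hence the excesses agree, and so do the
  distances to the three vertices.

  With the circumcenter of \<open>ABC\<close> as origin and \<open>t = cos A cos B cos C\<close>, one has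
  \<open>A' = - (cos\<^sup>2 A / t) A\<close>, and the circumcenter of \<open>A'B'C'\<close> is \<open>(1 - s) H + s K\<close> with
  \<open>s = (1 + t) (4 t - 1) / (4 t\<^sup>2)\<close>.\<close>

subsection \<open>Triangles and their centers\<close>

lemma noncollinear_barycentric:
  fixes A B C X :: point
  assumes "\<not> collinear {A, B, C}"
  obtains x y z where "x + y + z = 1" "X = x *\<^sub>R A + y *\<^sub>R B + z *\<^sub>R C"
proof -
  have "A \<noteq> B" "A \<noteq> C" "B \<noteq> C" "\<not> affine_dependent {A, B, C}"
    using assms by (auto simp: collinear_3_eq_affine_dependent)
  then have "affine hull {A, B, C} = UNIV"
    by (intro affine_independent_span_eq) auto
  then have "X \<in> {u *\<^sub>R A + v *\<^sub>R B + w *\<^sub>R C |u v w. u + v + w = 1}"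
    unfolding affine_hull_3[symmetric] by simp
  then show thesis
    using that by blast
qed

text \<open>Used contrapositively: equal affine combinations of the vertices of a triangle have
  equal coefficients.\<close>

lemma collinear_if_affine_combination:
  fixes A B C :: "'a::euclidean_space"
  assumes "x *\<^sub>R A + y *\<^sub>R B + z *\<^sub>R C = 0" "x + y + z = 0" "x \<noteq> 0"
  shows "collinear {A, B, C}"
proof -
  have "x *\<^sub>R A = (- y) *\<^sub>R B + (- z) *\<^sub>R C"
    using assms(1)
    by (metis add.assoc diff_conv_add_uminus eq_neg_iff_add_eq_0 minus_add_distrib
        scaleR_minus_left)
  then have "(1 / x) *\<^sub>R x *\<^sub>R A = (1 / x) *\<^sub>R ((- y) *\<^sub>R B + (- z) *\<^sub>R C)"
    by simp
  then have "A = (- y / x) *\<^sub>R B + (- z / x) *\<^sub>R C"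
    using assms(3) by (simp add: scaleR_right_diff_distrib)
  moreover have "- y / x + - z / x = 1"
    using assms(2,3) by (simp add: field_simps)
  ultimately have "A \<in> affine hull {B, C}"
    unfolding affine_hull_2 by blast
  then show ?thesis
    using affine_hull_3_imp_collinear[of A B C] by (simp add: insert_commute)
qed

text \<open>The vector \<open>d\<close> is a combination of the two sides, so
  \<open>d \<bullet> d\<close> vanishes. The uniqueness of circumcenter and orthocenter rests on
  this.\<close>

lemma orthogonal_to_sides_eq_0:
  fixes A B C d :: point
  assumes "\<not> collinear {A, B, C}" "d \<bullet> (B - A) = 0" "d \<bullet> (C - A) = 0"
  shows "d = 0"
proof -
  obtain x y z where s: "x + y + z = 1" and X: "A + d = x *\<^sub>R A + y *\<^sub>R B + z *\<^sub>R C"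
    using noncollinear_barycentric[OF assms(1)] by metis
  have "x = 1 - y - z"
    using s by simp
  then have "A + d = A + (y *\<^sub>R (B - A) + z *\<^sub>R (C - A))"
    unfolding X by (simp add: algebra_simps flip: scaleR_add_left)
  then have "d = y *\<^sub>R (B - A) + z *\<^sub>R (C - A)"
    by simp
  then have "d \<bullet> d = y * (d \<bullet> (B - A)) + z * (d \<bullet> (C - A))"
    by (metis inner_add_right inner_scaleR_right)
  then show ?thesis
    using assms(2,3) by simp
qed

text \<open>Squaring cancels \<open>X \<bullet> X\<close>, so a perpendicular bisector becomes a
  linear equation in \<open>X\<close>.\<close>

lemma dist_eq_iff_inner:
  fixes X A B :: "'a::real_inner"
  shows "dist X A = dist X B \<longleftrightarrow> 2 * (X \<bullet> (B - A)) = B \<bullet> B - A \<bullet> A"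
proof -
  have "dist X A = dist X B \<longleftrightarrow> (dist X A)\<^sup>2 = (dist X B)\<^sup>2"
    by simp
  also have "\<dots> \<longleftrightarrow> 2 * (X \<bullet> (B - A)) = B \<bullet> B - A \<bullet> A"
    by (auto simp: dist_norm power2_norm_eq_inner algebra_simps inner_commute)
  finally show ?thesis .
qed

lemma equidistant_unique:
  fixes A B C :: point
  assumes "\<not> collinear {A, B, C}"
    and "dist X A = dist X B" "dist X B = dist X C"
    and "dist Y A = dist Y B" "dist Y B = dist Y C"
  shows "X = Y"
proof -
  have "2 * (X \<bullet> (B - A)) = 2 * (Y \<bullet> (B - A))" "2 * (X \<bullet> (C - B)) = 2 * (Y \<bullet> (C - B))"
    using assms(2-)[unfolded dist_eq_iff_inner] by linarith+
  then have "X - Y = 0"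
    using orthogonal_to_sides_eq_0[OF assms(1), of "X - Y"]
    by (simp add: inner_diff_right inner_diff_left)
  then show ?thesis by simp
qed

lemma circumcenter_eqI:
  assumes "\<not> collinear {A, B, C}" "dist X A = dist X B" "dist X B = dist X C"
  shows "circumcenter A B C = X"
  unfolding circumcenter_def
  using assms equidistant_unique by (intro the_equality) blast+

lemma inner_real2: "x \<bullet> y = x $ 1 * y $ 1 + x $ 2 * y $ 2" for x y :: point
  by (simp add: inner_vec_def sum_2)

lemma circumcenter_exists:
  fixes A B C :: point
  assumes "\<not> collinear {A, B, C}"
  shows "\<exists>X. dist X A = dist X B \<and> dist X B = dist X C"
proof -
  define u v where "u = B - A" and "v = C - A"
  define D where "D = u $ 1 * v $ 2 - u $ 2 * v $ 1"
  have "D \<noteq> 0"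
  proof
    assume "D = 0"
    \<comment> \<open>The quarter turn of \<open>u\<close>; its inner product with \<open>v\<close>
      is the determinant \<open>D\<close>.\<close>
    define d :: point where "d = vector [- u $ 2, u $ 1]"
    have "d \<bullet> (B - A) = 0" "d \<bullet> (C - A) = 0"
      using \<open>D = 0\<close> unfolding u_def[symmetric] v_def[symmetric] D_def d_def
      by (simp_all add: inner_real2 algebra_simps)
    then have "d = 0"
      by (rule orthogonal_to_sides_eq_0[OF assms])
    then have "u $ 1 = 0" "u $ 2 = 0"
      unfolding d_def by (simp_all add: vec_eq_iff forall_2)
    then have "A = B"
      by (simp add: u_def vec_eq_iff forall_2)
    then show False
      using assms by simp
  qed
  define p q where "p = (B \<bullet> B - A \<bullet> A) / 2" and "q = (C \<bullet> C - A \<bullet> A) / 2"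
  \<comment> \<open>Cramer's rule for \<open>X \<bullet> u = p\<close> and
    \<open>X \<bullet> v = q\<close>, the equations of two perpendicular bisectors.\<close>
  define X :: point where
    "X = vector [(p * v $ 2 - q * u $ 2) / D, (q * u $ 1 - p * v $ 1) / D]"
  have "X \<bullet> u = (p * D) / D"
    unfolding X_def by (simp add: inner_real2 D_def divide_simps) (simp add: algebra_simps)
  moreover have "X \<bullet> v = (q * D) / D"
    unfolding X_def by (simp add: inner_real2 D_def divide_simps) (simp add: algebra_simps)
  ultimately have "X \<bullet> u = p" "X \<bullet> v = q"
    using \<open>D \<noteq> 0\<close> by simp_all
  then have "dist X A = dist X B" "dist X A = dist X C"
    unfolding dist_eq_iff_inner by (simp_all add: u_def v_def p_def q_def)
  then show ?thesis
    by metis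
qed

lemma circumcenter_equidistant:
  assumes "\<not> collinear {A, B, C}" "X = circumcenter A B C"
  shows "dist X A = dist X B" "dist X B = dist X C"
  using circumcenter_exists[OF assms(1)] circumcenter_eqI[OF assms(1)] assms(2) by metis+

text \<open>With the circumcenter as origin the orthocenter is the sum of the vertices: the sum and
  the difference of two vectors of equal length are orthogonal.\<close>

lemma orthocenter_eq:
  fixes A B C Q :: point
  assumes "\<not> collinear {A, B, C}" "dist Q A = dist Q B" "dist Q B = dist Q C"
  shows "orthocenter A B C = Q + (A - Q) + (B - Q) + (C - Q)"
  unfolding orthocenter_def
proof (rule the_equality)
  \<comment> \<open>Here \<open>2 * Q\<close> is the componentwise product in the ring
    \<open>real ^ 2\<close>, a form that simplification may produce when it collects copies of
    \<open>Q\<close>.\<close>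
  have Q2: "(2 * Q) \<bullet> Y = 2 * (Q \<bullet> Y)" for Y
    by (simp add: inner_real2 algebra_simps)
  let ?H = "Q + (A - Q) + (B - Q) + (C - Q)"
  show H: "(?H - A) \<bullet> (B - C) = 0 \<and> (?H - B) \<bullet> (C - A) = 0 \<and> (?H - C) \<bullet> (A - B) = 0"
    using assms(2,3) unfolding dist_eq_iff_inner
    by (simp add: inner_diff_left inner_diff_right inner_add_left inner_add_right
        inner_commute[of B A] inner_commute[of C A] inner_commute[of C B]
        inner_commute[of A Q] inner_commute[of B Q] inner_commute[of C Q] Q2)
  fix G assume G: "(G - A) \<bullet> (B - C) = 0 \<and> (G - B) \<bullet> (C - A) = 0 \<and> (G - C) \<bullet> (A - B) = 0"
  have "(G - ?H) \<bullet> (B - A) = 0" "(G - ?H) \<bullet> (C - A) = 0"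
    using G H by (auto simp: algebra_simps)
  then have "G - ?H = 0"
    by (rule orthogonal_to_sides_eq_0[OF assms(1)])
  then show "G = ?H"
    by simp
qed

subsection \<open>Vertices of ellipses\<close>

text \<open>The line is parametrized from the midpoint: the foci sit at \<open>-1/2\<close> and
  \<open>1/2\<close>, and the two vertices of an ellipse get opposite parameters.\<close>

lemma line_point_distances:
  fixes F G :: "'a::real_inner"
  shows "dist (midpoint F G + w *\<^sub>R (G - F)) F = \<bar>1/2 + w\<bar> * dist F G"
    and "dist (midpoint F G + w *\<^sub>R (G - F)) G = \<bar>1/2 - w\<bar> * dist F G"
proof -
  have "midpoint F G + w *\<^sub>R (G - F) - F = (1/2 + w) *\<^sub>R (G - F)"
    by (simp add: midpoint_def algebra_simps flip: scaleR_2)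
  then show "dist (midpoint F G + w *\<^sub>R (G - F)) F = \<bar>1/2 + w\<bar> * dist F G"
    by (simp add: dist_norm norm_minus_commute)
  have "midpoint F G + w *\<^sub>R (G - F) - G = (- (1/2 - w)) *\<^sub>R (G - F)"
    by (simp add: midpoint_def algebra_simps flip: scaleR_2)
  then show "dist (midpoint F G + w *\<^sub>R (G - F)) G = \<bar>1/2 - w\<bar> * dist F G"
    by (simp only: dist_norm norm_scaleR norm_minus_commute abs_minus_cancel)
qed

lemma line_eq_midpoint_param:
  fixes F G :: "'a::real_vector"
  shows "affine hull {F, G} = range (\<lambda>w. midpoint F G + w *\<^sub>R (G - F))"
proof -
  have *: "F + t *\<^sub>R (G - F) = midpoint F G + (t - 1/2) *\<^sub>R (G - F)" for t
    by (simp add: midpoint_def algebra_simps flip: scaleR_2)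
  have "surj (\<lambda>t::real. t - 1/2)"
    by (metis surj_def add_diff_cancel_right')
  then have "range (\<lambda>w. midpoint F G + w *\<^sub>R (G - F))
      = range ((\<lambda>w. midpoint F G + w *\<^sub>R (G - F)) \<circ> (\<lambda>t. t - 1/2))"
    by (metis image_comp)
  then show ?thesis
    unfolding affine_hull_2_alt * by (simp add: comp_def)
qed

text \<open>In units of \<open>dist F G\<close>, the sum of the distances to the foci is constant on
  the segment and \<open>2 * \<bar>t\<bar>\<close> outside it. The strict inequality puts the
  vertices outside.\<close>

lemma ellipse_vertices_eq:
  fixes F G P :: point
  assumes "F \<noteq> G" "dist F G < dist P F + dist P G"
    and w: "w = (dist P F + dist P G) / (2 * dist F G)"
  shows "ellipse_vertices F G P =
    {midpoint F G + w *\<^sub>R (G - F), midpoint F G + (- w) *\<^sub>R (G - F)}"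
proof -
  have pos: "dist F G > 0"
    using assms by auto
  then have "w > 1/2"
    using assms(2) unfolding w by (simp add: field_simps)
  have s: "dist P F + dist P G = 2 * w * dist F G"
    using pos w by simp
  have "ellipse_vertices F G P =
      (\<lambda>t. midpoint F G + t *\<^sub>R (G - F)) ` {t. \<bar>1/2 + t\<bar> + \<bar>1/2 - t\<bar> = 2 * w}"
    using pos
    by (auto simp: ellipse_vertices_def ellipse_through_def line_eq_midpoint_param
        line_point_distances s simp flip: distrib_right)
  also have "{t. \<bar>1/2 + t\<bar> + \<bar>1/2 - t\<bar> = 2 * w} = {w, - w}"
    using \<open>w > 1/2\<close> by (auto simp: abs_if split: if_splits)
  finally show ?thesis by simp
qed

text \<open>This inclusion survives the degenerate case \<open>w = 1/2\<close>, where the two points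
  are the foci, so it serves for arbitrary \<open>P\<close>.\<close>

lemma ellipse_vertices_supset:
  fixes F G P :: point
  assumes "F \<noteq> G"
    and w: "w = (dist P F + dist P G) / (2 * dist F G)"
  shows "{midpoint F G + w *\<^sub>R (G - F), midpoint F G + (- w) *\<^sub>R (G - F)}
     \<subseteq> ellipse_vertices F G P"
proof -
  have pos: "dist F G > 0"
    using assms by auto
  have "dist F G \<le> dist P F + dist P G"
    by (metis dist_commute dist_triangle)
  then have "w \<ge> 1/2"
    using pos unfolding w by (simp add: field_simps)
  have s: "dist P F + dist P G = 2 * w * dist F G"
    using pos w by simp
  have *: "\<bar>1/2 + w\<bar> + \<bar>1/2 - w\<bar> = 2 * w" "\<bar>1/2 + - w\<bar> + \<bar>1/2 - - w\<bar> = 2 * w"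
    using \<open>w \<ge> 1/2\<close> by auto
  have "midpoint F G + t *\<^sub>R (G - F) \<in> ellipse_vertices F G P"
    if "\<bar>1/2 + t\<bar> + \<bar>1/2 - t\<bar> = 2 * w" for t
    unfolding ellipse_vertices_def ellipse_through_def line_eq_midpoint_param
    using that by (auto simp: line_point_distances s simp flip: distrib_right)
  then show ?thesis
    using * by blast
qed

text \<open>Stewart's theorem for the point with affine coordinates \<open>1/2 - w\<close> and
  \<open>1/2 + w\<close>.\<close>

lemma stewart_midpoint:
  fixes F G Z :: "'a::real_inner"
  shows "(dist Z (midpoint F G + w *\<^sub>R (G - F)))\<^sup>2
    = (1/2 - w) * (dist Z F)\<^sup>2 + (1/2 + w) * (dist Z G)\<^sup>2 + (w\<^sup>2 - 1/4) * (dist F G)\<^sup>2"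
proof -
  define f g where "f = F - Z" and "g = G - Z"
  have 1: "midpoint F G + w *\<^sub>R (G - F) - Z = (1/2 - w) *\<^sub>R f + (1/2 + w) *\<^sub>R g"
    by (simp add: midpoint_def f_def g_def algebra_simps flip: scaleR_2)
  have 2: "G - F = g - f"
    by (simp add: f_def g_def)
  have "(norm ((1/2 - w) *\<^sub>R f + (1/2 + w) *\<^sub>R g))\<^sup>2
      = (1/2 - w) * (norm f)\<^sup>2 + (1/2 + w) * (norm g)\<^sup>2 + (w\<^sup>2 - 1/4) * (norm (g - f))\<^sup>2"
    unfolding power2_norm_eq_inner
    by (simp add: inner_diff_left inner_diff_right inner_add_left inner_add_right
        inner_commute[of g f] power2_eq_square) algebra
  then show ?thesis
    unfolding 1[symmetric] 2[symmetric]
    unfolding f_def g_def dist_norm[symmetric] by (simp only: dist_commute)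
qed

text \<open>The last term is the power of the point with respect to the circle about
  \<open>Z\<close> through \<open>F\<close> and \<open>G\<close>. It is even in \<open>w\<close>, so
  both vertices of an ellipse have the same power.\<close>

lemma power_of_line_point:
  fixes F G Z :: "'a::real_inner"
  assumes "dist Z F = dist Z G"
  shows "(dist Z (midpoint F G + w *\<^sub>R (G - F)))\<^sup>2
    = (dist Z F)\<^sup>2 + (w\<^sup>2 - 1/4) * (dist F G)\<^sup>2"
  unfolding stewart_midpoint assms by algebra

lemma equidistant_of_sphere:
  fixes F G Z :: "'a::real_inner"
  assumes "w \<noteq> 0"
    and "dist Z (midpoint F G + w *\<^sub>R (G - F)) = dist Z (midpoint F G + (- w) *\<^sub>R (G - F))"
  shows "dist Z F = dist Z G"
proof -
  have "w * ((dist Z F)\<^sup>2 - (dist Z G)\<^sup>2) = 0"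
    using arg_cong[OF assms(2), of "\<lambda>d. d\<^sup>2"]
    unfolding stewart_midpoint by algebra
  then show ?thesis
    using assms(1) by simp
qed

subsection \<open>Conics through the six vertices\<close>

definition quadratic_fn :: "real \<Rightarrow> real \<Rightarrow> real \<Rightarrow> real \<Rightarrow> real \<Rightarrow> real \<Rightarrow> point \<Rightarrow> real" where
  "quadratic_fn a b c d e f X =
     a * (X $ 1)\<^sup>2 + b * (X $ 1) * (X $ 2) + c * (X $ 2)\<^sup>2 + d * (X $ 1) + e * (X $ 2) + f"

lemma conic_iff_quadratic_fn:
  "conic S \<longleftrightarrow> (\<exists>a b c d e f. (a, b, c) \<noteq> (0, 0, 0) \<and> S = {X. quadratic_fn a b c d e f X = 0})"
  by (simp add: conic_def quadratic_fn_def)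

lemma conic_sphere:
  fixes Z :: point
  assumes "r > 0"
  shows "conic (sphere Z r)"
proof -
  have "X \<in> sphere Z r \<longleftrightarrow>
      quadratic_fn 1 0 1 (- 2 * Z $ 1) (- 2 * Z $ 2) (Z \<bullet> Z - r\<^sup>2) X = 0" for X
  proof -
    have "X \<in> sphere Z r \<longleftrightarrow> (dist Z X)\<^sup>2 = r\<^sup>2"
      using assms by (simp add: power2_eq_iff_nonneg)
    also have "(dist Z X)\<^sup>2 = r\<^sup>2 \<longleftrightarrow>
        quadratic_fn 1 0 1 (- 2 * Z $ 1) (- 2 * Z $ 2) (Z \<bullet> Z - r\<^sup>2) X = 0"
      unfolding dist_norm power2_norm_eq_inner inner_real2 quadratic_fn_def
      by (simp add: power2_eq_square) (auto simp: algebra_simps)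
    finally show ?thesis .
  qed
  then have "sphere Z r =
      {X. quadratic_fn 1 0 1 (- 2 * Z $ 1) (- 2 * Z $ 2) (Z \<bullet> Z - r\<^sup>2) X = 0}"
    by blast
  moreover have "(1, 0, 1) \<noteq> (0, 0, 0 :: real)"
    by simp
  ultimately show ?thesis
    unfolding conic_iff_quadratic_fn by blast
qed

lemma quadratic_fn_eq_0_imp:
  assumes "\<And>X. quadratic_fn a b c d e f X = 0"
  shows "(a, b, c) = (0, 0, 0)"
proof -
  have *: "a * x\<^sup>2 + b * x * y + c * y\<^sup>2 + d * x + e * y + f = 0" for x y
    using assms[of "vector [x, y]"] by (simp add: quadratic_fn_def)
  show ?thesis
    using *[of 0 0] *[of 1 0] *[of "-1" 0] *[of 0 1] *[of 0 "-1"] *[of 1 1] by simp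
qed

text \<open>On \<open>x + y + z = 1\<close> the polynomial becomes a quadratic form in the
  barycentric coordinates; evaluating at the midpoints identifies the mixed coefficients.\<close>

lemma quadratic_fn_barycentric:
  fixes A B C :: point
  assumes "F = quadratic_fn a b c d e f" "x + y + z = 1"
  shows "F (x *\<^sub>R A + y *\<^sub>R B + z *\<^sub>R C) = x\<^sup>2 * F A + y\<^sup>2 * F B + z\<^sup>2 * F C
    + y * z * (4 * F (midpoint B C) - F B - F C)
    + z * x * (4 * F (midpoint C A) - F C - F A)
    + x * y * (4 * F (midpoint A B) - F A - F B)"
proof -
  have x: "x = 1 - y - z"
    using assms(2) by simp
  show ?thesis
    unfolding assms(1) quadratic_fn_def midpoint_def x
    by (simp add: power2_eq_square) algebra
qed

lemma quadratic_fn_line: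
  fixes A B :: point
  assumes "F = quadratic_fn a b c d e f"
  shows "F (midpoint A B + w *\<^sub>R (B - A)) = (1/2 - w)\<^sup>2 * F A + (1/2 + w)\<^sup>2 * F B
    + (1/4 - w\<^sup>2) * (4 * F (midpoint A B) - F A - F B)"
proof -
  have "midpoint A B + w *\<^sub>R (B - A) = (1/2 - w) *\<^sub>R A + (1/2 + w) *\<^sub>R B + 0 *\<^sub>R A"
    by (simp add: midpoint_def algebra_simps)
  moreover have "(1/2 - w) * (1/2 + w) = 1/4 - w\<^sup>2"
    by (simp add: algebra_simps power2_eq_square)
  ultimately show ?thesis
    using quadratic_fn_barycentric[OF assms, of "1/2 - w" "1/2 + w" 0 A B A] by simp
qed

text \<open>The equations for \<open>w\<close> and \<open>- w\<close> differ by a multiple of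
  \<open>F B - F A\<close>. Once this vanishes, either of them can be solved for the mixed
  coefficient, as \<open>w\<^sup>2 \<noteq> 1/4\<close>.\<close>

lemma quadratic_fn_vertices:
  fixes A B :: point
  assumes "F = quadratic_fn a b c d e f" "w > 1/2"
    and "F (midpoint A B + w *\<^sub>R (B - A)) = 0" "F (midpoint A B + (- w) *\<^sub>R (B - A)) = 0"
  shows "F B = F A"
    and "4 * F (midpoint A B) - F A - F B = (2 * w\<^sup>2 + 1/2) / (w\<^sup>2 - 1/4) * F A"
proof -
  have 1: "(1/2 - w)\<^sup>2 * F A + (1/2 + w)\<^sup>2 * F B
    + (1/4 - w\<^sup>2) * (4 * F (midpoint A B) - F A - F B) = 0"
    using assms(3) unfolding quadratic_fn_line[OF assms(1)] .
  have 2: "(1/2 + w)\<^sup>2 * F A + (1/2 - w)\<^sup>2 * F B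
    + (1/4 - w\<^sup>2) * (4 * F (midpoint A B) - F A - F B) = 0"
    using assms(4) unfolding quadratic_fn_line[OF assms(1)] by simp
  have "w * (F B - F A) = 0"
    using 1 2 by algebra
  then show FB: "F B = F A"
    using assms(2) by simp
  have "(1/2) * (1/2) < w * w"
    using assms(2) by (intro mult_strict_mono) auto
  then have nz: "w\<^sup>2 - 1/4 > 0"
    by (simp add: power2_eq_square)
  have "(w\<^sup>2 - 1/4) * (4 * F (midpoint A B) - F A - F B) = (2 * w\<^sup>2 + 1/2) * F A"
    using 1 FB by algebra
  then show "4 * F (midpoint A B) - F A - F B = (2 * w\<^sup>2 + 1/2) / (w\<^sup>2 - 1/4) * F A"
    using nz by (simp add: field_simps)
qed

text \<open>The factor \<open>t\<close> depends on \<open>X\<close>, the triangle and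
  \<open>P\<close>, but not on \<open>F\<close>: any two quadratic functions that vanish at the six
  vertices are multiples of one common function.\<close>

lemma quadratic_fn_determined:
  fixes A B C P :: point
  assumes nc: "\<not> collinear {A, B, C}"
    and "dist B C < dist P B + dist P C" "dist C A < dist P C + dist P A"
      "dist A B < dist P A + dist P B"
  obtains t where
    "\<And>F a b c d e f. \<lbrakk>F = quadratic_fn a b c d e f; \<And>V. V \<in> six_vertices A B C P \<Longrightarrow> F V = 0\<rbrakk>
      \<Longrightarrow> F X = F A * t"
proof -
  define wa where "wa = (dist P B + dist P C) / (2 * dist B C)"
  define wb where "wb = (dist P C + dist P A) / (2 * dist C A)"
  define wc where "wc = (dist P A + dist P B) / (2 * dist A B)"
  have ne: "B \<noteq> C" "C \<noteq> A" "A \<noteq> B"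
    using nc by (auto simp: collinear_3_eq_affine_dependent)
  have w: "wa > 1/2" "wb > 1/2" "wc > 1/2"
    using assms(2-4) ne unfolding wa_def wb_def wc_def by (simp_all add: field_simps)
  have "midpoint B C + wa *\<^sub>R (C - B) \<in> six_vertices A B C P"
      "midpoint B C + (- wa) *\<^sub>R (C - B) \<in> six_vertices A B C P"
      "midpoint C A + wb *\<^sub>R (A - C) \<in> six_vertices A B C P"
      "midpoint C A + (- wb) *\<^sub>R (A - C) \<in> six_vertices A B C P"
      "midpoint A B + wc *\<^sub>R (B - A) \<in> six_vertices A B C P"
      "midpoint A B + (- wc) *\<^sub>R (B - A) \<in> six_vertices A B C P"
    unfolding six_vertices_def
    using ellipse_vertices_supset[OF ne(1) wa_def] ellipse_vertices_supset[OF ne(2) wb_def]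
      ellipse_vertices_supset[OF ne(3) wc_def]
    by blast+
  note V = this
  obtain x y z where s: "x + y + z = 1" and X: "X = x *\<^sub>R A + y *\<^sub>R B + z *\<^sub>R C"
    using noncollinear_barycentric[OF nc] by metis
  \<comment> \<open>The mixed coefficient of a side, divided by the common value of the function at
    the triangle vertices.\<close>
  define k where "k w = (2 * w\<^sup>2 + 1/2) / (w\<^sup>2 - 1/4)" for w :: real
  have *: "H X = H A * (x\<^sup>2 + y\<^sup>2 + z\<^sup>2 + y * z * k wa + z * x * k wb + x * y * k wc)"
    if H: "H = quadratic_fn a b c d e f" "\<And>X. X \<in> six_vertices A B C P \<Longrightarrow> H X = 0"
    for H a b c d e f
  proof -
    note 1 = quadratic_fn_vertices[OF H(1) w(1) H(2)[OF V(1)] H(2)[OF V(2)], folded k_def]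
    note 2 = quadratic_fn_vertices[OF H(1) w(2) H(2)[OF V(3)] H(2)[OF V(4)], folded k_def]
    note 3 = quadratic_fn_vertices[OF H(1) w(3) H(2)[OF V(5)] H(2)[OF V(6)], folded k_def]
    show ?thesis
      unfolding X quadratic_fn_barycentric[OF H(1) s] 1(2) 2(2) 3(2)
      unfolding 1(1) 3(1) by (simp add: algebra_simps)
  qed
  show thesis
    using that * by blast
qed

lemma is_Y_conicI:
  assumes nc: "\<not> collinear {A, B, C}"
    and lt: "dist B C < dist P B + dist P C" "dist C A < dist P C + dist P A"
      "dist A B < dist P A + dist P B"
    and Y: "conic Y" "six_vertices A B C P \<subseteq> Y"
  shows "is_Y_conic A B C P Y"
  unfolding is_Y_conic_def
proof (intro conjI Y allI impI, elim conjE)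
  fix Z assume Z: "conic Z" "six_vertices A B C P \<subseteq> Z"
  obtain a b c d e f where F: "(a, b, c) \<noteq> (0, 0, 0)" "Y = {X. quadratic_fn a b c d e f X = 0}"
    using Y(1) unfolding conic_iff_quadratic_fn by blast
  obtain a' b' c' d' e' f' where
    G: "(a', b', c') \<noteq> (0, 0, 0)" "Z = {X. quadratic_fn a' b' c' d' e' f' X = 0}"
    using Z(1) unfolding conic_iff_quadratic_fn by blast
  let ?F = "quadratic_fn a b c d e f" and ?G = "quadratic_fn a' b' c' d' e' f'"
  have FV: "?F X = 0" and GV: "?G X = 0" if "X \<in> six_vertices A B C P" for X
    using that Y(2) Z(2) F(2) G(2) by auto
  have *: "\<exists>t. ?F X = ?F A * t \<and> ?G X = ?G A * t" for X
    using quadratic_fn_determined[OF nc lt] FV GV by metis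
  \<comment> \<open>Value 0 at \<open>A\<close> would make the whole polynomial vanish. Hence both
    zero sets are the zero set of the common factor.\<close>
  have "?F A \<noteq> 0" "?G A \<noteq> 0"
    using * F(1) G(1) quadratic_fn_eq_0_imp by (metis mult_zero_left)+
  then show "Z = Y"
    using * unfolding F(2) G(2) by (metis mult_eq_0_iff)
qed

subsection \<open>Uniqueness of the point with a circle\<close>

text \<open>For \<open>Q\<close> in the triangle \<open>PBC\<close>, expanding \<open>Q - B\<close>
  and \<open>Q - C\<close> bounds both distances; the resulting multiple of \<open>dist B C\<close>
  is absorbed by \<open>dist B C \<le> dist P B + dist P C\<close>.\<close>

lemma convex_combination_sum_dist_le:
  fixes P Q B C :: "'a::real_normed_vector"
  assumes Q: "Q = m *\<^sub>R P + s *\<^sub>R B + t *\<^sub>R C" "m + s + t = 1" "m \<ge> 0" "s \<ge> 0" "t \<ge> 0"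
  shows "dist Q B + dist Q C \<le> dist P B + dist P C"
proof -
  have m: "m = 1 - s - t"
    using Q(2) by simp
  have "Q - B = m *\<^sub>R (P - B) + t *\<^sub>R (C - B)"
    unfolding Q(1) m by (simp add: algebra_simps)
  then have 1: "dist Q B \<le> m * dist P B + t * dist B C"
    using Q norm_triangle_ineq[of "m *\<^sub>R (P - B)" "t *\<^sub>R (C - B)"]
    by (simp add: dist_norm norm_minus_commute)
  have "Q - C = m *\<^sub>R (P - C) + s *\<^sub>R (B - C)"
    unfolding Q(1) m by (simp add: algebra_simps)
  then have 2: "dist Q C \<le> m * dist P C + s * dist B C"
    using Q norm_triangle_ineq[of "m *\<^sub>R (P - C)" "s *\<^sub>R (B - C)"]
    by (simp add: dist_norm norm_minus_commute)
  have "(s + t) * dist B C \<le> (s + t) * (dist P B + dist P C)"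
    using Q dist_triangle[of B C P] by (intro mult_left_mono) (auto simp: dist_commute)
  with 1 2 have "dist Q B + dist Q C \<le> (m + s + t) * (dist P B + dist P C)"
    by (simp add: algebra_simps)
  then show ?thesis
    using Q(2) by simp
qed

text \<open>Removing \<open>x' / x\<close> times \<open>P\<close> from \<open>Q\<close> eliminates
  \<open>A\<close>. The last two assumptions say that the remaining coefficients are nonnegative, so
  \<open>Q\<close> lies in the triangle \<open>PBC\<close>.\<close>

lemma cone_sum_dist_le:
  fixes A B C P Q :: "'a::real_normed_vector"
  assumes P: "P = x *\<^sub>R A + y *\<^sub>R B + z *\<^sub>R C" "x + y + z = 1" "x > 0"
    and Q: "Q = x' *\<^sub>R A + y' *\<^sub>R B + z' *\<^sub>R C" "x' + y' + z' = 1" "x' \<ge> 0"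
    and "x' / x * y \<le> y'" "x' / x * z \<le> z'"
  shows "dist Q B + dist Q C \<le> dist P B + dist P C"
proof (rule convex_combination_sum_dist_le)
  let ?m = "x' / x"
  have m: "?m * x = x'"
    using P(3) by simp
  show "Q = ?m *\<^sub>R P + (y' - ?m * y) *\<^sub>R B + (z' - ?m * z) *\<^sub>R C"
    unfolding P(1) Q(1) using m by (simp add: algebra_simps)
  have "?m * (x + y + z) = x' + ?m * y + ?m * z"
    using m by (simp add: distrib_left)
  then show "?m + (y' - ?m * y) + (z' - ?m * z) = 1"
    unfolding P(2) using Q(2) by linarith
qed (use assms in auto)

text \<open>The smallest of the ratios \<open>x' / x\<close>, \<open>y' / y\<close>,
  \<open>z' / z\<close> of barycentric coordinates tells which of the triangles \<open>PBC\<close>,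
  \<open>PCA\<close>, \<open>PAB\<close> contains \<open>Q\<close>.\<close>

lemma triangle_sum_dist_le:
  fixes A B C P Q :: point
  assumes "\<not> collinear {A, B, C}"
    and "P \<in> interior (convex hull {A, B, C})" "Q \<in> interior (convex hull {A, B, C})"
  shows "dist Q B + dist Q C \<le> dist P B + dist P C \<or>
    dist Q C + dist Q A \<le> dist P C + dist P A \<or>
    dist Q A + dist Q B \<le> dist P A + dist P B"
proof -
  have int: "interior (convex hull {A, B, C}) =
      {v. \<exists>x y z. 0 < x \<and> 0 < y \<and> 0 < z \<and> x + y + z = 1 \<and> x *\<^sub>R A + y *\<^sub>R B + z *\<^sub>R C = v}"
    by (rule interior_convex_hull_3_minimal) (use assms in simp_all)
  obtain x y z where P: "0 < x" "0 < y" "0 < z" "x + y + z = 1" "P = x *\<^sub>R A + y *\<^sub>R B + z *\<^sub>R C"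
    using assms(2) unfolding int by blast
  obtain x' y' z' where
    Q: "0 < x'" "0 < y'" "0 < z'" "x' + y' + z' = 1" "Q = x' *\<^sub>R A + y' *\<^sub>R B + z' *\<^sub>R C"
    using assms(3) unfolding int by blast
  consider "x' / x \<le> y' / y" "x' / x \<le> z' / z" | "y' / y \<le> z' / z" "y' / y \<le> x' / x"
    | "z' / z \<le> x' / x" "z' / z \<le> y' / y"
    by linarith
  then show ?thesis
  proof cases
    case 1
    then have "x' / x * y \<le> y'" "x' / x * z \<le> z'"
      using P by (simp_all add: field_simps)
    then show ?thesis
      using cone_sum_dist_le[OF P(5,4,1) Q(5,4)] Q(1) by simp
  next
    case 2
    then have "y' / y * z \<le> z'" "y' / y * x \<le> x'"
      using P by (simp_all add: field_simps)
    then show ?thesis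
      using cone_sum_dist_le[of P y B z C x A Q y' z' x'] P Q by (simp add: algebra_simps)
  next
    case 3
    then have "z' / z * x \<le> x'" "z' / z * y \<le> y'"
      using P by (simp_all add: field_simps)
    then show ?thesis
      using cone_sum_dist_le[of P z C x A y B Q z' x' y'] P Q by (simp add: algebra_simps)
  qed
qed

text \<open>The excess is four times the power of either vertex with respect to the circle about
  \<open>Z\<close> through the foci. Here \<open>P\<close> may lie on the segment
  \<open>FG\<close>.\<close>

lemma vertices_on_sphere:
  fixes F G P Z :: point
  assumes "F \<noteq> G" "ellipse_vertices F G P \<subseteq> sphere Z r"
  shows "dist Z F = dist Z G"
    and "(dist P F + dist P G)\<^sup>2 - (dist F G)\<^sup>2 = 4 * (r\<^sup>2 - (dist Z F)\<^sup>2)"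
proof -
  define w where "w = (dist P F + dist P G) / (2 * dist F G)"
  have "dist F G > 0" "dist F G \<le> dist P F + dist P G"
    using assms(1) by simp (metis dist_commute dist_triangle)
  then have "w > 0"
    unfolding w_def by (intro divide_pos_pos) linarith+
  then have "w \<noteq> 0"
    by simp
  have on: "dist Z (midpoint F G + w *\<^sub>R (G - F)) = r"
      "dist Z (midpoint F G + (- w) *\<^sub>R (G - F)) = r"
    using ellipse_vertices_supset[OF assms(1) w_def] assms(2) by auto
  show eq: "dist Z F = dist Z G"
    by (rule equidistant_of_sphere[OF \<open>w \<noteq> 0\<close>]) (simp only: on)
  have "dist P F + dist P G = 2 * w * dist F G"
    using \<open>dist F G > 0\<close> by (simp add: w_def)
  moreover have "r\<^sup>2 = (dist Z F)\<^sup>2 + (w\<^sup>2 - 1/4) * (dist F G)\<^sup>2"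
    using power_of_line_point[OF eq, of w] on by simp
  ultimately show "(dist P F + dist P G)\<^sup>2 - (dist F G)\<^sup>2 = 4 * (r\<^sup>2 - (dist Z F)\<^sup>2)"
    by algebra
qed

text \<open>The converse needs a proper ellipse: in the degenerate case
  \<open>ellipse_vertices\<close> is a whole segment, which no circle contains.\<close>

lemma sphere_contains_vertices:
  fixes F G P Z :: point
  assumes "F \<noteq> G" "dist F G < dist P F + dist P G" "dist Z F = dist Z G" "r \<ge> 0"
    and "(dist P F + dist P G)\<^sup>2 - (dist F G)\<^sup>2 = 4 * (r\<^sup>2 - (dist Z F)\<^sup>2)"
  shows "ellipse_vertices F G P \<subseteq> sphere Z r"
proof -
  define w where "w = (dist P F + dist P G) / (2 * dist F G)"
  have "dist P F + dist P G = 2 * w * dist F G"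
    using \<open>F \<noteq> G\<close> by (simp add: w_def)
  then have "(dist Z F)\<^sup>2 + (w\<^sup>2 - 1/4) * (dist F G)\<^sup>2 = r\<^sup>2"
    using assms(5) by algebra
  then have "(dist Z (midpoint F G + w *\<^sub>R (G - F)))\<^sup>2 = r\<^sup>2"
    "(dist Z (midpoint F G + (- w) *\<^sub>R (G - F)))\<^sup>2 = r\<^sup>2"
    unfolding power_of_line_point[OF assms(3)] by simp_all
  then show ?thesis
    unfolding ellipse_vertices_eq[OF assms(1,2) w_def]
    using assms(4) by (simp add: power2_eq_iff_nonneg)
qed

lemma Y_is_circle_excess:
  assumes "\<not> collinear {A, B, C}" "Y_is_circle A B C P"
  obtains k where "(dist P B + dist P C)\<^sup>2 - (dist B C)\<^sup>2 = k"
    "(dist P C + dist P A)\<^sup>2 - (dist C A)\<^sup>2 = k"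
    "(dist P A + dist P B)\<^sup>2 - (dist A B)\<^sup>2 = k"
proof -
  obtain Z r where Y: "six_vertices A B C P \<subseteq> sphere Z r"
    using assms(2) unfolding Y_is_circle_def is_Y_conic_def by blast
  have ne: "B \<noteq> C" "C \<noteq> A" "A \<noteq> B"
    using assms(1) by (auto simp: collinear_3_eq_affine_dependent)
  have sub: "ellipse_vertices B C P \<subseteq> sphere Z r" "ellipse_vertices C A P \<subseteq> sphere Z r"
    "ellipse_vertices A B P \<subseteq> sphere Z r"
    using Y unfolding six_vertices_def by blast+
  note 1 = vertices_on_sphere[OF ne(1) sub(1)] and 2 = vertices_on_sphere[OF ne(2) sub(2)]
    and 3 = vertices_on_sphere[OF ne(3) sub(3)]
  show thesis
    by (rule that[OF 1(2)]) (metis 1(1) 2(2), metis 3)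
qed

text \<open>Otherwise \<open>A\<close>, \<open>B\<close>, \<open>C\<close> would all lie on the
  perpendicular bisector of \<open>PQ\<close>.\<close>

lemma eq_if_distances_eq:
  fixes A B C P Q :: point
  assumes "\<not> collinear {A, B, C}"
    and "dist P A = dist Q A" "dist P B = dist Q B" "dist P C = dist Q C"
  shows "P = Q"
proof -
  have "dist A P = dist A Q" "dist B P = dist B Q" "dist C P = dist C Q"
    using assms(2-) by (simp_all add: dist_commute)
  then have "A \<bullet> (Q - P) = B \<bullet> (Q - P)" "A \<bullet> (Q - P) = C \<bullet> (Q - P)"
    unfolding dist_eq_iff_inner by linarith+
  then have "(Q - P) \<bullet> (B - A) = 0" "(Q - P) \<bullet> (C - A) = 0"
    by (simp_all add: inner_commute[of "Q - P"] inner_diff_left[of _ _ "Q - P"])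
  then have "Q - P = 0"
    by (rule orthogonal_to_sides_eq_0[OF assms(1)])
  then show ?thesis
    by simp
qed

lemma Y_is_circle_unique:
  assumes nc: "\<not> collinear {A, B, C}"
    and P: "P \<in> interior (convex hull {A, B, C})" "Y_is_circle A B C P"
    and Q: "Q \<in> interior (convex hull {A, B, C})" "Y_is_circle A B C Q"
  shows "P = Q"
proof -
  obtain k where k: "(dist P B + dist P C)\<^sup>2 - (dist B C)\<^sup>2 = k"
    "(dist P C + dist P A)\<^sup>2 - (dist C A)\<^sup>2 = k" "(dist P A + dist P B)\<^sup>2 - (dist A B)\<^sup>2 = k"
    using Y_is_circle_excess[OF nc P(2)] by blast
  obtain l where l: "(dist Q B + dist Q C)\<^sup>2 - (dist B C)\<^sup>2 = l"
    "(dist Q C + dist Q A)\<^sup>2 - (dist C A)\<^sup>2 = l" "(dist Q A + dist Q B)\<^sup>2 - (dist A B)\<^sup>2 = l"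
    using Y_is_circle_excess[OF nc Q(2)] by blast
  have sq: "(dist U V + dist U' V')\<^sup>2 \<le> (dist X Y + dist X' Y')\<^sup>2"
    if "dist U V + dist U' V' \<le> dist X Y + dist X' Y'" for U V U' V' X Y X' Y' :: point
    using that by (intro power_mono) auto
  have "l \<le> k"
    using triangle_sum_dist_le[OF nc P(1) Q(1)]
  proof (elim disjE)
  qed (drule sq; use k l in linarith)+
  moreover have "k \<le> l"
    using triangle_sum_dist_le[OF nc Q(1) P(1)]
  proof (elim disjE)
  qed (drule sq; use k l in linarith)+
  ultimately have "k = l"
    by simp
  then have "(dist P B + dist P C)\<^sup>2 = (dist Q B + dist Q C)\<^sup>2"
    "(dist P C + dist P A)\<^sup>2 = (dist Q C + dist Q A)\<^sup>2"
    "(dist P A + dist P B)\<^sup>2 = (dist Q A + dist Q B)\<^sup>2"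
    using k l by linarith+
  then have "dist P B + dist P C = dist Q B + dist Q C" "dist P C + dist P A = dist Q C + dist Q A"
    "dist P A + dist P B = dist Q A + dist Q B"
    by (simp_all add: power2_eq_iff_nonneg)
  \<comment> \<open>The three pairwise sums determine the three distances.\<close>
  then show ?thesis
    by (intro eq_if_distances_eq[OF nc]) linarith+
qed

subsection \<open>The anticevian triangle of the circumcenter\<close>

text \<open>A point of the line \<open>B'C'\<close> has \<open>A'\<close>-coordinate 0, which fixes
  its position on the line \<open>A'Q\<close>. For \<open>x = 1\<close> no point of the line
  \<open>A'Q\<close> has \<open>A'\<close>-coordinate 0.\<close>

lemma cevian_foot:
  fixes A A' B' C' Q :: point
  assumes nc: "\<not> collinear {A', B', C'}"
    and Q: "Q = x *\<^sub>R A' + y *\<^sub>R B' + z *\<^sub>R C'" "x + y + z = 1"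
    and A: "A \<in> affine hull {A', Q}" "A \<in> affine hull {B', C'}"
  shows "x \<noteq> 1" and "(1 - x) *\<^sub>R (A - Q) = (- x) *\<^sub>R (A' - Q)"
proof -
  obtain u v where uv: "u + v = 1" "A = u *\<^sub>R A' + v *\<^sub>R Q"
    using A(1) unfolding affine_hull_2 by blast
  obtain s t where st: "s + t = 1" "A = s *\<^sub>R B' + t *\<^sub>R C'"
    using A(2) unfolding affine_hull_2 by blast
  have "u *\<^sub>R A' + v *\<^sub>R Q - (s *\<^sub>R B' + t *\<^sub>R C') = 0"
    using uv(2) st(2) by simp
  then have "(u + v * x) *\<^sub>R A' + (v * y - s) *\<^sub>R B' + (v * z - t) *\<^sub>R C' = 0"
    unfolding Q(1) by (simp add: algebra_simps)
  moreover have "(u + v * x) + (v * y - s) + (v * z - t) = 0"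
    using uv(1) st(1) Q(2) by algebra
  ultimately have "u + v * x = 0"
    using collinear_if_affine_combination nc by blast
  then have v: "v * (1 - x) = 1"
    using uv(1) by algebra
  then show "x \<noteq> 1"
    by auto
  have "A - Q = u *\<^sub>R (A' - Q)"
    using uv by (simp add: algebra_simps flip: scaleR_add_left)
  moreover have "(1 - x) * u = - x"
    using v uv(1) by algebra
  ultimately show "(1 - x) *\<^sub>R (A - Q) = (- x) *\<^sub>R (A' - Q)"
    by simp
qed

text \<open>Isolate the \<open>\<alpha>\<close> term and compare squared norms. With 0 as
  circumcenter, \<open>\<beta> \<bullet> \<gamma> + \<rho>\<close> is \<open>2 * \<rho>\<close>
  times the squared cosine of the angle at \<open>\<alpha>\<close>.\<close>

lemma inner_of_weighted_sum_0:
  fixes \<alpha> \<beta> \<gamma> :: "'a::real_inner"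
  assumes "(1 - x) *\<^sub>R \<alpha> + (1 - y) *\<^sub>R \<beta> + (1 - z) *\<^sub>R \<gamma> = 0" "x + y + z = 1"
    and "\<alpha> \<bullet> \<alpha> = \<rho>" "\<beta> \<bullet> \<beta> = \<rho>" "\<gamma> \<bullet> \<gamma> = \<rho>"
  shows "(1 - y) * (1 - z) * (\<beta> \<bullet> \<gamma> + \<rho>) = 2 * \<rho> * y * z"
proof -
  have "(1 - y) *\<^sub>R \<beta> + (1 - z) *\<^sub>R \<gamma> = - ((1 - x) *\<^sub>R \<alpha>)"
    using assms(1) by (metis add.assoc add_eq_0_iff)
  then have "((1 - y) *\<^sub>R \<beta> + (1 - z) *\<^sub>R \<gamma>) \<bullet> ((1 - y) *\<^sub>R \<beta> + (1 - z) *\<^sub>R \<gamma>)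
      = ((1 - x) *\<^sub>R \<alpha>) \<bullet> ((1 - x) *\<^sub>R \<alpha>)"
    by simp
  then have "(1 - y) * (1 - y) * \<rho> + 2 * (1 - y) * (1 - z) * (\<beta> \<bullet> \<gamma>) + (1 - z) * (1 - z) * \<rho>
      = (1 - x) * (1 - x) * \<rho>"
    unfolding inner_add_left inner_add_right inner_scaleR_left inner_scaleR_right
      inner_commute[of \<gamma> \<beta>] assms(3-5) by algebra
  moreover have "x = 1 - y - z"
    using assms(2) by simp
  ultimately show ?thesis
    by algebra
qed

lemma excess_eq:
  fixes b c \<beta> \<gamma> :: "'a::real_inner"
  assumes "b = (- ((1 - y) / y)) *\<^sub>R \<beta>" "c = (- ((1 - z) / z)) *\<^sub>R \<gamma>" "y \<noteq> 0" "z \<noteq> 0"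
    and inner: "(1 - y) * (1 - z) * (\<beta> \<bullet> \<gamma> + \<rho>) = 2 * \<rho> * y * z"
    and "\<beta> \<bullet> \<beta> = \<rho>" "\<gamma> \<bullet> \<gamma> = \<rho>" "\<rho> > 0"
  shows "(norm b + norm c)\<^sup>2 - (norm (b - c))\<^sup>2 = 4 * \<rho>"
proof -
  define g where "g = (1 - y) / y * ((1 - z) / z)"
  have g: "g * (\<beta> \<bullet> \<gamma> + \<rho>) = 2 * \<rho>"
    using inner assms(3,4) unfolding g_def by (simp add: divide_simps mult_ac)
  have norms: "norm \<beta> = sqrt \<rho>" "norm \<gamma> = sqrt \<rho>"
    using assms(6,7) by (simp_all add: norm_eq_sqrt_inner)
  have "\<bar>\<beta> \<bullet> \<gamma>\<bar> \<le> \<rho>"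
    using Cauchy_Schwarz_ineq2[of \<beta> \<gamma>] assms(8) unfolding norms by simp
  then have "\<beta> \<bullet> \<gamma> + \<rho> \<ge> 0"
    by linarith
  \<comment> \<open>Cauchy-Schwarz settles the sign of \<open>g\<close> without assuming an acute
    triangle; it lets the product of the norms be \<open>g * \<rho>\<close>.\<close>
  then have "g > 0"
    using g \<open>\<rho> > 0\<close> by (metis mult_nonpos_nonneg not_le mult_pos_pos zero_less_numeral)
  have "norm b * norm c = \<bar>g\<bar> * \<rho>"
    using assms(8) unfolding assms(1,2) g_def by (simp add: norms abs_mult)
  then have nn: "norm b * norm c = g * \<rho>"
    using \<open>g > 0\<close> by simp
  have bc: "b \<bullet> c = g * (\<beta> \<bullet> \<gamma>)"
    unfolding assms(1,2) g_def by (simp add: mult_ac)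
  have "(norm b + norm c)\<^sup>2 - (norm (b - c))\<^sup>2 = 2 * (norm b * norm c) + 2 * (b \<bullet> c)"
    by (simp add: power2_sum power2_norm_eq_inner inner_diff_left inner_diff_right
        inner_commute[of c b])
  also have "\<dots> = 2 * (g * (\<beta> \<bullet> \<gamma> + \<rho>))"
    unfolding nn bc by algebra
  finally show ?thesis
    unfolding g by simp
qed

text \<open>\<open>u\<close>, \<open>v\<close>, \<open>w\<close> are the squared cosines of the angles of the triangle
  \<open>\<alpha>\<close>, \<open>\<beta>\<close>, \<open>\<gamma>\<close> with circumcenter 0, and \<open>t\<close> is the product of the three cosines.\<close>

lemma center_inner:
  fixes \<alpha> \<beta> \<gamma> :: "'a::real_inner"
  assumes "u + v + w + 2 * t = 1" "u * v * w = t\<^sup>2" "u \<noteq> 0" "t \<noteq> 0"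
    and "\<alpha> \<bullet> \<alpha> = \<rho>" "\<alpha> \<bullet> \<beta> = \<rho> * (2 * w - 1)" "\<alpha> \<bullet> \<gamma> = \<rho> * (2 * v - 1)"
    and Z: "(8 * t\<^sup>2) *\<^sub>R Z = (1 - 2 * t - (4 * t - 1) * u) *\<^sub>R \<alpha>
      + (1 - 2 * t - (4 * t - 1) * v) *\<^sub>R \<beta> + (1 - 2 * t - (4 * t - 1) * w) *\<^sub>R \<gamma>"
  shows "(norm (Z - (- (u / t)) *\<^sub>R \<alpha>))\<^sup>2 = (norm Z)\<^sup>2 - \<rho> * (4 * t - 1) / t"
proof -
  have "8 * t\<^sup>2 * (\<alpha> \<bullet> Z) = \<alpha> \<bullet> ((8 * t\<^sup>2) *\<^sub>R Z)"
    by simp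
  also have "\<dots> = \<rho> * ((1 - 2 * t - (4 * t - 1) * u) + (1 - 2 * t - (4 * t - 1) * v) * (2 * w - 1)
      + (1 - 2 * t - (4 * t - 1) * w) * (2 * v - 1))"
    unfolding Z inner_add_right inner_scaleR_right assms(5-7) by algebra
  finally have 1: "8 * t\<^sup>2 * (\<alpha> \<bullet> Z) =
      \<rho> * ((1 - 2 * t - (4 * t - 1) * u) + (1 - 2 * t - (4 * t - 1) * v) * (2 * w - 1)
      + (1 - 2 * t - (4 * t - 1) * w) * (2 * v - 1))" .
  have w: "w = 1 - u - v - 2 * t"
    using assms(1) by simp
  have "8 * t\<^sup>2 * (\<alpha> \<bullet> Z) = - \<rho> * (4 * t * u + 4 * (4 * t - 1) * (v * w))"
    unfolding 1 w by algebra
  \<comment> \<open>The factor \<open>u\<close> brings in \<open>u * v * w = t\<^sup>2\<close>,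
    after which \<open>4 * t\<close> can be cancelled.\<close>
  then have "8 * t\<^sup>2 * (u * (\<alpha> \<bullet> Z)) = - \<rho> * (4 * t * u\<^sup>2 + 4 * (4 * t - 1) * t\<^sup>2)"
    using assms(2) by algebra
  then have "t * (2 * t * (u * (\<alpha> \<bullet> Z))) = t * (- \<rho> * (u\<^sup>2 + (4 * t - 1) * t))"
    by algebra
  then have *: "2 * t * (u * (\<alpha> \<bullet> Z)) = - \<rho> * (u\<^sup>2 + (4 * t - 1) * t)"
    using assms(4) by (metis mult_left_cancel)
  have "(norm (Z - s *\<^sub>R \<alpha>))\<^sup>2 = (norm Z)\<^sup>2 - 2 * s * (\<alpha> \<bullet> Z) + s\<^sup>2 * \<rho>" for s
    unfolding power2_norm_eq_inner inner_diff_left inner_diff_right inner_scaleR_left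
      inner_scaleR_right inner_commute[of Z \<alpha>] assms(5) by algebra
  from this[of "- (u / t)"] have "(norm (Z - (- (u / t)) *\<^sub>R \<alpha>))\<^sup>2
      = (norm Z)\<^sup>2 + (2 * (u / t) * (\<alpha> \<bullet> Z) + (u / t)\<^sup>2 * \<rho>)"
    by simp
  also have "2 * (u / t) * (\<alpha> \<bullet> Z) + (u / t)\<^sup>2 * \<rho> = (2 * t * (u * (\<alpha> \<bullet> Z)) + u\<^sup>2 * \<rho>) / t\<^sup>2"
    using assms(4) by (simp add: field_simps power2_eq_square)
  \<comment> \<open>The result no longer involves \<open>u\<close>, so the three vertices have the
    same distance from \<open>Z\<close>.\<close>
  also have "\<dots> = - \<rho> * (4 * t - 1) / t"
    unfolding * using assms(4) by (simp add: field_simps power2_eq_square)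
  finally show ?thesis
    by simp
qed

text \<open>The weights \<open>1 - u\<close>, \<open>1 - v\<close>, \<open>1 - w\<close> of the
  symmedian point are squared sines. Each coefficient of \<open>Z\<close> splits into
  \<open>8 * t\<^sup>2 * (1 - s)\<close> for the orthocenter and \<open>4 * t - 1\<close> times such
  a weight.\<close>

lemma center_on_line:
  fixes \<alpha> \<beta> \<gamma> Z :: "'a::real_vector"
  assumes "t \<noteq> 0" "t \<noteq> - 1"
    and Z: "(8 * t\<^sup>2) *\<^sub>R Z = (1 - 2 * t - (4 * t - 1) * u) *\<^sub>R \<alpha>
      + (1 - 2 * t - (4 * t - 1) * v) *\<^sub>R \<beta> + (1 - 2 * t - (4 * t - 1) * w) *\<^sub>R \<gamma>"
    and K: "(2 * (1 + t)) *\<^sub>R K = (1 - u) *\<^sub>R \<alpha> + (1 - v) *\<^sub>R \<beta> + (1 - w) *\<^sub>R \<gamma>"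
    and s: "s = (1 + t) * (4 * t - 1) / (4 * t\<^sup>2)"
  shows "Z = (1 - s) *\<^sub>R (\<alpha> + \<beta> + \<gamma>) + s *\<^sub>R K"
proof -
  have 1: "8 * t\<^sup>2 * s = (2 * (1 + t)) * (4 * t - 1)"
    using assms(1) s by (simp add: field_simps)
  have 2: "1 - 2 * t - (4 * t - 1) * e = 8 * t\<^sup>2 * (1 - s) + (4 * t - 1) * (1 - e)" for e
    using 1 by algebra
  have "(8 * t\<^sup>2) *\<^sub>R s *\<^sub>R K = (4 * t - 1) *\<^sub>R (2 * (1 + t)) *\<^sub>R K"
    by (simp only: scaleR_scaleR 1 mult.commute[of "4 * t - 1"])
  then have "(8 * t\<^sup>2) *\<^sub>R Z = (8 * t\<^sup>2) *\<^sub>R ((1 - s) *\<^sub>R (\<alpha> + \<beta> + \<gamma>) + s *\<^sub>R K)"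
    unfolding Z K 2 by (simp only: scaleR_add_right scaleR_add_left scaleR_scaleR add_ac)
  then show ?thesis
    using assms(1) by (simp only: scaleR_cancel_left) simp
qed

lemma symmedian_point_eq:
  fixes A B C Q :: point
  assumes "(dist B C)\<^sup>2 + (dist C A)\<^sup>2 + (dist A B)\<^sup>2 \<noteq> 0"
  shows "((dist B C)\<^sup>2 + (dist C A)\<^sup>2 + (dist A B)\<^sup>2) *\<^sub>R (symmedian_point A B C - Q) =
    (dist B C)\<^sup>2 *\<^sub>R (A - Q) + (dist C A)\<^sup>2 *\<^sub>R (B - Q) + (dist A B)\<^sup>2 *\<^sub>R (C - Q)"
proof -
  have "((dist B C)\<^sup>2 + (dist C A)\<^sup>2 + (dist A B)\<^sup>2) *\<^sub>R symmedian_point A B C =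
      (dist B C)\<^sup>2 *\<^sub>R A + (dist C A)\<^sup>2 *\<^sub>R B + (dist A B)\<^sup>2 *\<^sub>R C"
    using assms unfolding symmedian_point_def by simp
  then show ?thesis
    unfolding scaleR_diff_right[of _ "symmedian_point A B C"] by (simp add: algebra_simps)
qed

text \<open>With \<open>x : y : z\<close> the barycentric coordinates of the circumcenter with respect to the
  anticevian triangle, those with respect to \<open>ABC\<close> are \<open>1 - x : 1 - y : 1 - z\<close>.\<close>

lemma circumcenter_anticevian:
  fixes A B C A' B' C' Q :: point
  assumes nc: "\<not> collinear {A, B, C}"
    and Q: "dist Q A = dist Q B" "dist Q B = dist Q C"
    and anti: "is_anticevian_triangle Q A B C A' B' C'"
  obtains x y z \<rho> where
    "x + y + z = 1" "Q = x *\<^sub>R A' + y *\<^sub>R B' + z *\<^sub>R C'" "\<rho> > 0"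
    "x \<noteq> 0" "y \<noteq> 0" "z \<noteq> 0" "x \<noteq> 1" "y \<noteq> 1" "z \<noteq> 1"
    "(A - Q) \<bullet> (A - Q) = \<rho>" "(B - Q) \<bullet> (B - Q) = \<rho>" "(C - Q) \<bullet> (C - Q) = \<rho>"
    "A' - Q = (- ((1 - x) / x)) *\<^sub>R (A - Q)"
    "B' - Q = (- ((1 - y) / y)) *\<^sub>R (B - Q)"
    "C' - Q = (- ((1 - z) / z)) *\<^sub>R (C - Q)"
    "(1 - y) * (1 - z) * ((B - Q) \<bullet> (C - Q) + \<rho>) = 2 * \<rho> * y * z"
    "(1 - z) * (1 - x) * ((C - Q) \<bullet> (A - Q) + \<rho>) = 2 * \<rho> * z * x"
    "(1 - x) * (1 - y) * ((A - Q) \<bullet> (B - Q) + \<rho>) = 2 * \<rho> * x * y"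
proof -
  have nc': "\<not> collinear {A', B', C'}" "\<not> collinear {B', C', A'}" "\<not> collinear {C', A', B'}"
    using anti unfolding is_anticevian_triangle_def by (simp_all add: insert_commute)
  have mem: "A \<in> affine hull {A', Q}" "A \<in> affine hull {B', C'}"
    "B \<in> affine hull {B', Q}" "B \<in> affine hull {C', A'}"
    "C \<in> affine hull {C', Q}" "C \<in> affine hull {A', B'}"
    using anti unfolding is_anticevian_triangle_def by blast+
  obtain x y z where s: "x + y + z = 1" "Q = x *\<^sub>R A' + y *\<^sub>R B' + z *\<^sub>R C'"
    using noncollinear_barycentric[OF nc'(1)] by metis
  have s': "y + z + x = 1" "Q = y *\<^sub>R B' + z *\<^sub>R C' + x *\<^sub>R A'"
    "z + x + y = 1" "Q = z *\<^sub>R C' + x *\<^sub>R A' + y *\<^sub>R B'"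
    using s by (simp_all add: add_ac)
  note fA = cevian_foot[OF nc'(1) s(2,1) mem(1,2)]
    and fB = cevian_foot[OF nc'(2) s'(2,1) mem(3,4)]
    and fC = cevian_foot[OF nc'(3) s'(4,3) mem(5,6)]
  define \<rho> where "\<rho> = (A - Q) \<bullet> (A - Q)"
  have sq: "(X - Q) \<bullet> (X - Q) = (dist Q X)\<^sup>2" for X
    by (metis dist_norm dist_commute power2_norm_eq_inner)
  have r: "(A - Q) \<bullet> (A - Q) = \<rho>" "(B - Q) \<bullet> (B - Q) = \<rho>" "(C - Q) \<bullet> (C - Q) = \<rho>"
    unfolding \<rho>_def sq using Q by simp_all
  have "\<rho> \<noteq> 0"
  proof
    assume "\<rho> = 0"
    then have "A = Q" "B = Q"
      using r by simp_all
    then show False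
      using nc by simp
  qed
  then have ne: "A - Q \<noteq> 0" "B - Q \<noteq> 0" "C - Q \<noteq> 0"
    using r by auto
  have "\<rho> > 0"
    using \<open>\<rho> \<noteq> 0\<close> unfolding \<rho>_def by (metis inner_ge_zero less_le)
  have vert: "e \<noteq> 0 \<and> X' - Q = (- ((1 - e) / e)) *\<^sub>R (X - Q)"
    if "e \<noteq> 1" "(1 - e) *\<^sub>R (X - Q) = (- e) *\<^sub>R (X' - Q)" "X - Q \<noteq> 0" for e X X'
  proof
    show "e \<noteq> 0"
      using that by auto
    then have "X' - Q = (- (1 / e)) *\<^sub>R (- e) *\<^sub>R (X' - Q)"
      by simp
    then show "X' - Q = (- ((1 - e) / e)) *\<^sub>R (X - Q)"
      unfolding that(2)[symmetric] by simp
  qed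
  note vA = vert[OF fA ne(1)] and vB = vert[OF fB ne(2)] and vC = vert[OF fC ne(3)]
  \<comment> \<open>Relative to \<open>Q\<close> the weighted sum of the vertices \<open>A'\<close>,
    \<open>B'\<close>, \<open>C'\<close> is 0; \<open>cevian_foot\<close> carries this over to
    \<open>A\<close>, \<open>B\<close>, \<open>C\<close>.\<close>
  have "x *\<^sub>R (A' - Q) + y *\<^sub>R (B' - Q) + z *\<^sub>R (C' - Q)
      = (x *\<^sub>R A' + y *\<^sub>R B' + z *\<^sub>R C') - (x + y + z) *\<^sub>R Q"
    by (simp add: algebra_simps)
  then have "- (x *\<^sub>R (A' - Q) + y *\<^sub>R (B' - Q) + z *\<^sub>R (C' - Q)) = 0"
    using s by simp
  then have sum: "(1 - x) *\<^sub>R (A - Q) + (1 - y) *\<^sub>R (B - Q) + (1 - z) *\<^sub>R (C - Q) = 0"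
    unfolding fA(2) fB(2) fC(2) by (simp add: algebra_simps)
  then have sum': "(1 - y) *\<^sub>R (B - Q) + (1 - z) *\<^sub>R (C - Q) + (1 - x) *\<^sub>R (A - Q) = 0"
    "(1 - z) *\<^sub>R (C - Q) + (1 - x) *\<^sub>R (A - Q) + (1 - y) *\<^sub>R (B - Q) = 0"
    by (simp_all only: add_ac)
  show thesis
    using vA vB vC
    by (intro that[OF s \<open>\<rho> > 0\<close> _ _ _ fA(1) fB(1) fC(1) r _ _ _
          inner_of_weighted_sum_0[OF sum s(1) r] inner_of_weighted_sum_0[OF sum'(1) s'(1) r(2,3,1)]
          inner_of_weighted_sum_0[OF sum'(2) s'(3) r(3,1,2)]]) blast+
qed

theorem proposition10:
  fixes A B C A' B' C' X3 :: point
  assumes "\<not> collinear {A, B, C}"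
    and "X3 = circumcenter A B C"
    and "is_anticevian_triangle X3 A B C A' B' C'"
  shows "(\<exists>Z r. r > 0 \<and> is_Y_conic A' B' C' X3 (sphere Z r) \<and>
            Z = circumcenter A' B' C' \<and>
            Z \<in> affine hull {orthocenter A B C, symmedian_point A B C}) \<and>
         (acute_triangle A B C \<longrightarrow> is_P_star A' B' C' X3)"
proof -

  \<comment> \<open>Squared cosines in terms of barycentric coordinates\<close>
  note nc = assms(1)
  have nc': "\<not> collinear {A', B', C'}"
    using assms(3) unfolding is_anticevian_triangle_def by blast
  have ne': "B' \<noteq> C'" "C' \<noteq> A'" "A' \<noteq> B'"
    using nc' by (auto simp: collinear_3_eq_affine_dependent)
  note eq = circumcenter_equidistant[OF nc assms(2)]
  obtain x y z \<rho> where
    s: "x + y + z = 1" and X3: "X3 = x *\<^sub>R A' + y *\<^sub>R B' + z *\<^sub>R C'" and "\<rho> > 0"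
    and nz: "x \<noteq> 0" "y \<noteq> 0" "z \<noteq> 0" "x \<noteq> 1" "y \<noteq> 1" "z \<noteq> 1"
    and r: "(A - X3) \<bullet> (A - X3) = \<rho>" "(B - X3) \<bullet> (B - X3) = \<rho>" "(C - X3) \<bullet> (C - X3) = \<rho>"
    and vert: "A' - X3 = (- ((1 - x) / x)) *\<^sub>R (A - X3)"
      "B' - X3 = (- ((1 - y) / y)) *\<^sub>R (B - X3)" "C' - X3 = (- ((1 - z) / z)) *\<^sub>R (C - X3)"
    and inner: "(1 - y) * (1 - z) * ((B - X3) \<bullet> (C - X3) + \<rho>) = 2 * \<rho> * y * z"
      "(1 - z) * (1 - x) * ((C - X3) \<bullet> (A - X3) + \<rho>) = 2 * \<rho> * z * x"
      "(1 - x) * (1 - y) * ((A - X3) \<bullet> (B - X3) + \<rho>) = 2 * \<rho> * x * y"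
    using circumcenter_anticevian[OF nc eq assms(3)] by metis
  define p q l where "p = 1 - x" and "q = 1 - y" and "l = 1 - z"
  have pql: "p \<noteq> 0" "q \<noteq> 0" "l \<noteq> 0" "x = 1 - p" "y = 1 - q" "z = 1 - l"
    using nz unfolding p_def q_def l_def by simp_all
  have l: "l = 2 - p - q"
    using s pql by simp
  define u v w t where "u = y * z / (q * l)" and "v = z * x / (l * p)" and "w = x * y / (p * q)"
    and "t = x * y * z / (p * q * l)"
  have uvwt: "u \<noteq> 0" "v \<noteq> 0" "w \<noteq> 0" "t \<noteq> 0"
    unfolding u_def v_def w_def t_def using nz pql(1-3) by simp_all
  have prod: "u * v * w = t\<^sup>2"
    unfolding u_def v_def w_def t_def by (simp add: power2_eq_square mult_ac)
  \<comment> \<open>After division by \<open>p * q * l\<close> this is the classical identity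
    between the squared cosines of the angles and the product of the cosines.\<close>
  have "p * (y * z) + q * (z * x) + l * (x * y) + 2 * (x * y * z) = p * q * l"
    unfolding pql(4-6) l by algebra
  then have "(p * (y * z) + q * (z * x) + l * (x * y) + 2 * (x * y * z)) / (p * q * l) = 1"
    using pql(1-3) by simp
  then have sum: "u + v + w + 2 * t = 1"
    unfolding u_def v_def w_def t_def using pql(1-3) by (simp add: add_divide_distrib mult_ac)
  have ratio: "u / t = p / x" "v / t = q / y" "w / t = l / z"
    unfolding u_def v_def w_def t_def using nz pql(1-3) by (simp_all add: divide_simps)
  define \<alpha> \<beta> \<gamma> where "\<alpha> = A - X3" and "\<beta> = B - X3" and "\<gamma> = C - X3"
  have dots: "\<beta> \<bullet> \<gamma> = \<rho> * (2 * u - 1)" "\<gamma> \<bullet> \<alpha> = \<rho> * (2 * v - 1)" "\<alpha> \<bullet> \<beta> = \<rho> * (2 * w - 1)"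
    using inner pql(1-3) unfolding u_def v_def w_def
    unfolding \<alpha>_def[symmetric] \<beta>_def[symmetric] \<gamma>_def[symmetric]
      p_def[symmetric] q_def[symmetric] l_def[symmetric]
    by (simp_all add: field_simps)
  note r' = r[folded \<alpha>_def \<beta>_def \<gamma>_def]
  have vert': "A' - X3 = (- (u / t)) *\<^sub>R \<alpha>" "B' - X3 = (- (v / t)) *\<^sub>R \<beta>"
    "C' - X3 = (- (w / t)) *\<^sub>R \<gamma>"
    using vert unfolding ratio \<alpha>_def \<beta>_def \<gamma>_def p_def q_def l_def by simp_all

  \<comment> \<open>The common excess and nondegeneracy of the three ellipses\<close>
  have dist_X3: "dist X3 X = norm (X - X3)" for X
    by (simp add: dist_norm norm_minus_commute)
  have dist_diff: "dist X Y = norm ((X - X3) - (Y - X3))" for X Y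
    by (simp add: dist_norm)
  have excess: "(dist X3 B' + dist X3 C')\<^sup>2 - (dist B' C')\<^sup>2 = 4 * \<rho>"
    "(dist X3 C' + dist X3 A')\<^sup>2 - (dist C' A')\<^sup>2 = 4 * \<rho>"
    "(dist X3 A' + dist X3 B')\<^sup>2 - (dist A' B')\<^sup>2 = 4 * \<rho>"
    unfolding dist_X3 dist_diff[of B'] dist_diff[of C'] dist_diff[of A']
    using excess_eq[OF vert(2,3) nz(2,3) inner(1) r(2,3) \<open>\<rho> > 0\<close>]
      excess_eq[OF vert(3,1) nz(3,1) inner(2) r(3,1) \<open>\<rho> > 0\<close>]
      excess_eq[OF vert(1,2) nz(1,2) inner(3) r(1,2) \<open>\<rho> > 0\<close>] by blast+
  have lt: "a < b" if "b\<^sup>2 - a\<^sup>2 = 4 * \<rho>" "b \<ge> 0" for a b :: real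
    using that \<open>\<rho> > 0\<close> by (intro power2_less_imp_less[of a b]) auto
  have lts: "dist B' C' < dist X3 B' + dist X3 C'" "dist C' A' < dist X3 C' + dist X3 A'"
    "dist A' B' < dist X3 A' + dist X3 B'"
    using excess by (auto intro!: lt)

  \<comment> \<open>The circumcenter of the anticevian triangle\<close>
  define D where "D = (1 / (8 * t\<^sup>2)) *\<^sub>R ((1 - 2 * t - (4 * t - 1) * u) *\<^sub>R \<alpha>
      + (1 - 2 * t - (4 * t - 1) * v) *\<^sub>R \<beta> + (1 - 2 * t - (4 * t - 1) * w) *\<^sub>R \<gamma>)"
  have D: "(8 * t\<^sup>2) *\<^sub>R D = (1 - 2 * t - (4 * t - 1) * u) *\<^sub>R \<alpha>
      + (1 - 2 * t - (4 * t - 1) * v) *\<^sub>R \<beta> + (1 - 2 * t - (4 * t - 1) * w) *\<^sub>R \<gamma>"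
    unfolding D_def using uvwt by simp
  have D': "(8 * t\<^sup>2) *\<^sub>R D = (1 - 2 * t - (4 * t - 1) * v) *\<^sub>R \<beta>
      + (1 - 2 * t - (4 * t - 1) * w) *\<^sub>R \<gamma> + (1 - 2 * t - (4 * t - 1) * u) *\<^sub>R \<alpha>"
    "(8 * t\<^sup>2) *\<^sub>R D = (1 - 2 * t - (4 * t - 1) * w) *\<^sub>R \<gamma>
      + (1 - 2 * t - (4 * t - 1) * u) *\<^sub>R \<alpha> + (1 - 2 * t - (4 * t - 1) * v) *\<^sub>R \<beta>"
    unfolding D by (simp_all only: add_ac)
  define Z where "Z = X3 + D"
  have dist_Z: "(dist Z X)\<^sup>2 = (norm (D - (X - X3)))\<^sup>2" for X
    by (simp add: Z_def dist_norm algebra_simps)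
  define \<kappa> where "\<kappa> = (norm D)\<^sup>2 - \<rho> * (4 * t - 1) / t"
  have sum': "v + w + u + 2 * t = 1" "w + u + v + 2 * t = 1" "v * w * u = t\<^sup>2" "w * u * v = t\<^sup>2"
    using sum prod by (simp_all add: ac_simps)
  have "(dist Z A')\<^sup>2 = \<kappa>"
    unfolding dist_Z vert' \<kappa>_def
    by (rule center_inner[OF sum prod uvwt(1,4) r'(1) dots(3) _ D])
      (use dots(2) in \<open>simp add: inner_commute\<close>)
  moreover have "(dist Z B')\<^sup>2 = \<kappa>"
    unfolding dist_Z vert' \<kappa>_def
    by (rule center_inner[OF sum'(1,3) uvwt(2,4) r'(2) dots(1) _ D'(1)])
      (use dots(3) in \<open>simp add: inner_commute\<close>)
  moreover have "(dist Z C')\<^sup>2 = \<kappa>"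
    unfolding dist_Z vert' \<kappa>_def
    by (rule center_inner[OF sum'(2,4) uvwt(3,4) r'(3) dots(2) _ D'(2)])
      (use dots(1) in \<open>simp add: inner_commute\<close>)
  ultimately have Z: "dist Z A' = dist Z B'" "dist Z B' = dist Z C'"
    by (metis power2_eq_iff_nonneg zero_le_dist)+
  have circ: "circumcenter A' B' C' = Z"
    by (rule circumcenter_eqI[OF nc' Z])

  \<comment> \<open>The circle through the six vertices\<close>
  define R where "R = sqrt ((dist Z A')\<^sup>2 + \<rho>)"
  \<comment> \<open>With this radius, \<open>4 * \<rho>\<close> is the excess required by
    \<open>sphere_contains_vertices\<close>.\<close>
  have R: "R\<^sup>2 = (dist Z A')\<^sup>2 + \<rho>" "R > 0"
    using \<open>\<rho> > 0\<close> unfolding R_def by (simp_all add: add_nonneg_pos)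
  have "six_vertices A' B' C' X3 \<subseteq> sphere Z R"
    unfolding six_vertices_def Un_subset_iff
    using Z R excess by (intro conjI sphere_contains_vertices ne' lts) auto
  then have Y: "is_Y_conic A' B' C' X3 (sphere Z R)"
    by (intro is_Y_conicI[OF nc' lts] conic_sphere R)

  \<comment> \<open>The center on the line through orthocenter and symmedian point\<close>
  have sides: "(dist B C)\<^sup>2 = 4 * \<rho> * (1 - u)" "(dist C A)\<^sup>2 = 4 * \<rho> * (1 - v)"
    "(dist A B)\<^sup>2 = 4 * \<rho> * (1 - w)"
  proof -
    have *: "(norm (a - b))\<^sup>2 = 4 * \<rho> * (1 - e)"
      if "a \<bullet> a = \<rho>" "b \<bullet> b = \<rho>" "a \<bullet> b = \<rho> * (2 * e - 1)" for a b :: point and e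
      unfolding power2_norm_eq_inner inner_diff_left inner_diff_right inner_commute[of b a] that
      by algebra
    show "(dist B C)\<^sup>2 = 4 * \<rho> * (1 - u)" "(dist C A)\<^sup>2 = 4 * \<rho> * (1 - v)"
      "(dist A B)\<^sup>2 = 4 * \<rho> * (1 - w)"
      unfolding dist_diff[of B] dist_diff[of C] dist_diff[of A]
      unfolding \<alpha>_def[symmetric] \<beta>_def[symmetric] \<gamma>_def[symmetric]
      by (rule *[OF r'(2,3) dots(1)], rule *[OF r'(3,1) dots(2)], rule *[OF r'(1,2) dots(3)])
  qed
  have sides_sum: "(dist B C)\<^sup>2 + (dist C A)\<^sup>2 + (dist A B)\<^sup>2 = 4 * \<rho> * (2 * (1 + t))"
    unfolding sides using sum by algebra
  have "A \<noteq> B"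
    using nc by auto
  then have "(dist B C)\<^sup>2 + (dist C A)\<^sup>2 + (dist A B)\<^sup>2 > 0"
    by (intro add_nonneg_pos) auto
  then have sides_nz: "(dist B C)\<^sup>2 + (dist C A)\<^sup>2 + (dist A B)\<^sup>2 \<noteq> 0"
    by linarith
  then have "t \<noteq> - 1"
    unfolding sides_sum by auto
  define K where "K = symmedian_point A B C - X3"
  have "(4 * \<rho>) *\<^sub>R (2 * (1 + t)) *\<^sub>R K
      = (4 * \<rho>) *\<^sub>R ((1 - u) *\<^sub>R \<alpha> + (1 - v) *\<^sub>R \<beta> + (1 - w) *\<^sub>R \<gamma>)"
    using symmedian_point_eq[OF sides_nz, of X3] unfolding sides_sum
    unfolding sides K_def \<alpha>_def \<beta>_def \<gamma>_def
    by (simp add: scaleR_add_right)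
  then have K: "(2 * (1 + t)) *\<^sub>R K = (1 - u) *\<^sub>R \<alpha> + (1 - v) *\<^sub>R \<beta> + (1 - w) *\<^sub>R \<gamma>"
    using \<open>\<rho> > 0\<close> by (simp only: scaleR_cancel_left) simp
  define \<tau> where "\<tau> = (1 + t) * (4 * t - 1) / (4 * t\<^sup>2)"
  have "D = (1 - \<tau>) *\<^sub>R (\<alpha> + \<beta> + \<gamma>) + \<tau> *\<^sub>R K"
    by (rule center_on_line[OF uvwt(4) \<open>t \<noteq> - 1\<close> D K \<tau>_def])
  moreover have "orthocenter A B C = X3 + (\<alpha> + \<beta> + \<gamma>)"
    unfolding orthocenter_eq[OF nc eq] \<alpha>_def \<beta>_def \<gamma>_def by (simp only: add.assoc)
  moreover have "symmedian_point A B C = X3 + K"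
    by (simp add: K_def)
  ultimately have "Z = (1 - \<tau>) *\<^sub>R orthocenter A B C + \<tau> *\<^sub>R symmedian_point A B C"
    unfolding Z_def by (simp add: algebra_simps)
  moreover have "1 - \<tau> + \<tau> = 1"
    by simp
  ultimately have on_line: "Z \<in> affine hull {orthocenter A B C, symmedian_point A B C}"
    unfolding affine_hull_2 by blast

  \<comment> \<open>Acute triangles: the circumcenter is interior to the anticevian triangle\<close>
  have "is_P_star A' B' C' X3" if acute: "acute_triangle A B C"
  proof -
    have angle: "(b - a) \<bullet> (c - a) = 4 * \<rho> * (e + t)"
      if "a \<bullet> a = \<rho>" "b \<bullet> c = \<rho> * (2 * e - 1)" "c \<bullet> a = \<rho> * (2 * f - 1)"
        "a \<bullet> b = \<rho> * (2 * g - 1)" "e + f + g + 2 * t = 1" for a b c :: point and e f g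
      unfolding inner_diff_left inner_diff_right inner_commute[of b a] inner_commute[of a c]
        that(1-4)
      using that(5) by algebra
    have diffs: "B - A = \<beta> - \<alpha>" "C - A = \<gamma> - \<alpha>" "C - B = \<gamma> - \<beta>" "A - B = \<alpha> - \<beta>"
      "A - C = \<alpha> - \<gamma>" "B - C = \<beta> - \<gamma>"
      unfolding \<alpha>_def \<beta>_def \<gamma>_def by simp_all
    have "4 * \<rho> * (u + t) > 0 \<and> 4 * \<rho> * (v + t) > 0 \<and> 4 * \<rho> * (w + t) > 0"
      using acute
      unfolding acute_triangle_def diffs angle[OF r'(1) dots sum]
        angle[OF r'(2) dots(2,3,1) sum'(1)] angle[OF r'(3) dots(3,1,2) sum'(2)]
      by (elim conjE) (intro conjI)
    moreover have "4 * \<rho> > 0"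
      using \<open>\<rho> > 0\<close> by simp
    ultimately have pos: "u + t > 0" "v + t > 0" "w + t > 0"
      by (metis zero_less_mult_pos)+
    \<comment> \<open>Since \<open>p + x = 1\<close>, the positive number \<open>u + t\<close>
      equals \<open>y * z / N\<close>, and similarly for the other two angles.\<close>
    define N where "N = p * q * l"
    have "u = p * (y * z) / N" "v = q * (z * x) / N" "w = l * (x * y) / N"
      unfolding u_def v_def w_def N_def using pql(1-3) by (simp_all add: mult_ac)
    moreover have "t = x * (y * z) / N" "t = y * (z * x) / N" "t = z * (x * y) / N"
      unfolding t_def N_def by (simp_all add: mult_ac)
    ultimately have "u + t = (p + x) * (y * z) / N" "v + t = (q + y) * (z * x) / N"
      "w + t = (l + z) * (x * y) / N"
      unfolding distrib_right add_divide_distrib by argo+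
    then have N: "y * z / N > 0" "z * x / N > 0" "x * y / N > 0"
      using pos pql by simp_all
    \<comment> \<open>Multiplying two of the quotients squares the shared factor and
      \<open>N\<close>. Hence \<open>x\<close>, \<open>y\<close>, \<open>z\<close> share one sign,
      which is positive because their sum is 1.\<close>
    have sgn: "a * c > 0" if "a * b / N > 0" "b * c / N > 0" for a b c
    proof -
      have "(a * b / N) * (b * c / N) = (a * c) * (b / N)\<^sup>2"
        by (simp add: power2_eq_square)
      then have "(a * c) * (b / N)\<^sup>2 > 0"
        using mult_pos_pos[OF that] by argo
      then show ?thesis
        by (metis mult_nonpos_nonneg not_le zero_le_power2)
    qed
    have xy: "x * y > 0"
      using sgn[of y z x] N by (simp add: mult.commute)
    have xz: "x * z > 0"
      using sgn[OF N(3,1)] .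
    have "x > 0"
    proof (rule ccontr)
      assume "\<not> x > 0"
      then have "x < 0" "y < 0" "z < 0"
        using xy xz by (auto simp: zero_less_mult_iff)
      then show False
        using s by linarith
    qed
    then have "x > 0 \<and> y > 0 \<and> z > 0"
      using xy xz by (simp add: zero_less_mult_iff)
    moreover have "interior (convex hull {A', B', C'}) =
      {v. \<exists>x y z. 0 < x \<and> 0 < y \<and> 0 < z \<and> x + y + z = 1 \<and> x *\<^sub>R A' + y *\<^sub>R B' + z *\<^sub>R C' = v}"
      by (rule interior_convex_hull_3_minimal) (use nc' in simp_all)
    ultimately have "X3 \<in> interior (convex hull {A', B', C'})"
      using s X3 by blast
    moreover have "Y_is_circle A' B' C' X3"
      unfolding Y_is_circle_def using Y R by blast
    ultimately show ?thesis
      unfolding is_P_star_def using Y_is_circle_unique[OF nc'] by metis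
  qed
  moreover have "R > 0 \<and> is_Y_conic A' B' C' X3 (sphere Z R) \<and> Z = circumcenter A' B' C' \<and>
      Z \<in> affine hull {orthocenter A B C, symmedian_point A B C}"
    by (intro conjI R(2) Y circ[symmetric] on_line)
  ultimately show ?thesis
    by blast
qed

end
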